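(* Let $f\in H^2(\mathbb{B})$ be such that $f(0)\ne0$ and let $p_n$ be the optimal approximant of $f^{-\ast}$ of degree $n\in\mathbb{N}$. Then all the zeros of $p_n$ lie outside the closed unit ball $\overline{\mathbb{B}}$.
   Context: $\mathbb{H}$ is the skew field of quaternions, $\mathbb{B}=\{q\in\mathbb{H}:|q|<1\}$, and $\mathbb{N}$ includes $0$. $H^2(\mathbb{B})$ is the space of functions $f:\mathbb{B}\to\mathbb{H}$, $f(q)=\sum_{n\ge0}q^na_n$ with $a_n\in\mathbb{H}$ and $\|f\|_{H^2}^2=\sum_{n\ge0}|a_n|^2<\infty$; it is a right quaternionic Hilbert space with inner product $\langle\sum q^na_n,\sum q^nb_n\rangle=\sum_{n\ge0}\overline{b_n}a_n$. The $\ast$-product of $f=\sum q^na_n$ and $g=\sum q^nb_n$ is $f\ast g(q)=\sum_{n\ge0}q^n\sum_{k=0}^na_kb_{n-k}$, and $f^{-\ast}$ denotes the inverse of $f$ with respect to $\ast$. Let $\mathcal{P}_n=\{p(q)=\sum_{k=0}^nq^ka_k: a_k\in\mathbb{H}\}$. For $f\in H^2(\mathbb{B})$, the optimal approximant of degree $n$ of $f^{-\ast}$ is the (unique) $p_n\in\mathcal{P}_n$ such that $\|f\ast p_n-1\|_{H^2}=\min\{\|f\ast p-1\|_{H^2}:p\in\mathcal{P}_n\}$; equivalently $f\ast p_n$ is the orthogonal projection of the constant function $1$ onto $f\ast\mathcal{P}_n$. Polynomials in $\mathcal{P}_n$ are regarded as functions on all of $\mathbb{H}$, and their zeros are points of $\mathbb{H}$.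 *)

theory Defs
  imports "HOL-Analysis.Analysis"
begin

section \<open>The skew field of quaternions\<close>

datatype quat = Quat (qRe: real) (qI: real) (qJ: real) (qK: real)

lemma quat_eq_iff: "x = y \<longleftrightarrow> qRe x = qRe y \<and> qI x = qI y \<and> qJ x = qJ y \<and> qK x = qK y"
  by (cases x; cases y) simp

instantiation quat :: real_vector
begin

definition zero_quat :: quat where "0 = Quat 0 0 0 0"

definition plus_quat :: "quat \<Rightarrow> quat \<Rightarrow> quat"
  where "x + y = Quat (qRe x + qRe y) (qI x + qI y) (qJ x + qJ y) (qK x + qK y)"

definition uminus_quat :: "quat \<Rightarrow> quat"
  where "- x = Quat (- qRe x) (- qI x) (- qJ x) (- qK x)"

definition minus_quat :: "quat \<Rightarrow> quat \<Rightarrow> quat"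
  where "x - y = Quat (qRe x - qRe y) (qI x - qI y) (qJ x - qJ y) (qK x - qK y)"

definition scaleR_quat :: "real \<Rightarrow> quat \<Rightarrow> quat"
  where "scaleR r x = Quat (r * qRe x) (r * qI x) (r * qJ x) (r * qK x)"

instance
  by standard
    (simp_all add: zero_quat_def plus_quat_def uminus_quat_def minus_quat_def scaleR_quat_def
      algebra_simps)

end

instantiation quat :: euclidean_space
begin

definition inner_quat :: "quat \<Rightarrow> quat \<Rightarrow> real"
  where "inner x y = qRe x * qRe y + qI x * qI y + qJ x * qJ y + qK x * qK y"

definition norm_quat :: "quat \<Rightarrow> real"
  where "norm x = sqrt (inner x x)" for x :: quat

definition sgn_quat :: "quat \<Rightarrow> quat"
  where "sgn x = x /\<^sub>R norm x" for x :: quat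

definition dist_quat :: "quat \<Rightarrow> quat \<Rightarrow> real"
  where "dist x y = norm (x - y)" for x y :: quat

definition uniformity_quat :: "(quat \<times> quat) filter"
  where "uniformity = (INF e\<in>{0 <..}. principal {(x :: quat, y). dist x y < e})"

definition open_quat :: "quat set \<Rightarrow> bool"
  where "open U \<longleftrightarrow> (\<forall>x\<in>U. eventually (\<lambda>(x', y). x' = x \<longrightarrow> y \<in> U) uniformity)"
  for U :: "quat set"

definition Basis_quat :: "quat set"
  where "Basis = {Quat 1 0 0 0, Quat 0 1 0 0, Quat 0 0 1 0, Quat 0 0 0 1}"

instance
proof
  fix x y z :: quat and r :: real
  show "dist x y = norm (x - y)"
    by (rule dist_quat_def)
  show "sgn x = x /\<^sub>R norm x"
    by (rule sgn_quat_def)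
  show "uniformity = (INF e\<in>{0 <..}. principal {(x, y :: quat). dist x y < e})"
    by (rule uniformity_quat_def)
  show "open U \<longleftrightarrow> (\<forall>x\<in>U. eventually (\<lambda>(x', y). x' = x \<longrightarrow> y \<in> U) uniformity)"
    for U :: "quat set"
    by (rule open_quat_def)
  show "inner x y = inner y x"
    by (simp add: inner_quat_def algebra_simps)
  show "inner (x + y) z = inner x z + inner y z"
    by (simp add: inner_quat_def plus_quat_def algebra_simps)
  show "inner (r *\<^sub>R x) y = r * inner x y"
    by (simp add: inner_quat_def scaleR_quat_def algebra_simps)
  show "0 \<le> inner x x"
    by (simp add: inner_quat_def)
  show "inner x x = 0 \<longleftrightarrow> x = 0"
    by (simp add: inner_quat_def zero_quat_def quat_eq_iff add_nonneg_eq_0_iff)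
  show "norm x = sqrt (inner x x)"
    by (rule norm_quat_def)
  show "(Basis :: quat set) \<noteq> {}" "finite (Basis :: quat set)"
    by (simp_all add: Basis_quat_def)
  show "inner u v = (if u = v then 1 else 0)" if "u \<in> Basis" "v \<in> Basis" for u v :: quat
    using that unfolding Basis_quat_def by (elim insertE emptyE) (simp_all add: inner_quat_def)
  show "(\<forall>u\<in>Basis. inner x u = 0) \<longleftrightarrow> x = 0"
    by (cases x) (simp add: Basis_quat_def inner_quat_def zero_quat_def)
qed

end

instantiation quat :: real_normed_div_algebra
begin

definition one_quat :: quat where "1 = Quat 1 0 0 0"

definition times_quat :: "quat \<Rightarrow> quat \<Rightarrow> quat"
  where "x * y = Quat
    (qRe x * qRe y - qI x * qI y - qJ x * qJ y - qK x * qK y)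
    (qRe x * qI y + qI x * qRe y + qJ x * qK y - qK x * qJ y)
    (qRe x * qJ y - qI x * qK y + qJ x * qRe y + qK x * qI y)
    (qRe x * qK y + qI x * qJ y - qJ x * qI y + qK x * qRe y)"

definition inverse_quat :: "quat \<Rightarrow> quat"
  where "inverse x = Quat (qRe x) (- qI x) (- qJ x) (- qK x) /\<^sub>R (norm x)\<^sup>2"

definition divide_quat :: "quat \<Rightarrow> quat \<Rightarrow> quat"
  where "x div y = x * inverse y" for x y :: quat

instance
proof
  fix x y z :: quat and r :: real
  have norm_sq: "(norm u)\<^sup>2 = (qRe u)\<^sup>2 + (qI u)\<^sup>2 + (qJ u)\<^sup>2 + (qK u)\<^sup>2" for u :: quat
    unfolding power2_norm_eq_inner by (simp add: inner_quat_def power2_eq_square)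
  show "x * y * z = x * (y * z)"
    by (simp add: times_quat_def algebra_simps)
  show "1 * x = x" "x * 1 = x"
    by (simp_all add: times_quat_def one_quat_def)
  show "(x + y) * z = x * z + y * z" "x * (y + z) = x * y + x * z"
    by (simp_all add: times_quat_def plus_quat_def algebra_simps)
  show "(0::quat) \<noteq> 1"
    by (simp add: zero_quat_def one_quat_def)
  show "r *\<^sub>R x * y = r *\<^sub>R (x * y)" "x * r *\<^sub>R y = r *\<^sub>R (x * y)"
    by (simp_all add: times_quat_def scaleR_quat_def algebra_simps)
  show "x div y = x * inverse y"
    by (rule divide_quat_def)
  show "inverse (0::quat) = 0"
    by (simp add: inverse_quat_def zero_quat_def scaleR_quat_def)
  have "x * Quat (qRe x) (- qI x) (- qJ x) (- qK x) = (norm x)\<^sup>2 *\<^sub>R 1"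
    "Quat (qRe x) (- qI x) (- qJ x) (- qK x) * x = (norm x)\<^sup>2 *\<^sub>R 1"
    unfolding norm_sq
    by (simp_all add: times_quat_def scaleR_quat_def one_quat_def power2_eq_square)
  moreover have "u * s *\<^sub>R v = s *\<^sub>R (u * v)" "s *\<^sub>R u * v = s *\<^sub>R (u * v)" for u v :: quat and s
    by (simp_all add: times_quat_def scaleR_quat_def algebra_simps)
  ultimately show "inverse x * x = 1" "x * inverse x = 1" if "x \<noteq> 0"
    using that by (simp_all add: inverse_quat_def)
  have "(norm (x * y))\<^sup>2 = (norm x * norm y)\<^sup>2"
    unfolding norm_sq power_mult_distrib times_quat_def quat.sel by algebra
  then show "norm (x * y) = norm x * norm y"
    by (rule power2_eq_imp_eq) simp_all
qed

end


section \<open>The Hardy space of the quaternionic unit ball\<close>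

text \<open>
  A function on the unit ball is modelled by a total function on \<^typ>\<open>quat\<close>, of which only the
  values on \<open>ball 0 1\<close> are used. The variable is written to the left of the coefficients.
\<close>

definition has_qpowser :: "(quat \<Rightarrow> quat) \<Rightarrow> (nat \<Rightarrow> quat) \<Rightarrow> bool"
  where "has_qpowser f a \<longleftrightarrow> (\<forall>q\<in>ball 0 1. (\<lambda>n. q ^ n * a n) sums f q)"

lemma real_powser_eq_0:
  fixes c :: "nat \<Rightarrow> real"
  assumes c: "\<And>t. \<bar>t\<bar> < 1 \<Longrightarrow> (\<lambda>n. c n * t ^ n) sums 0"
  shows "c m = 0"
proof (induction m rule: less_induct)
  case (less m)
  have shifted: "(\<lambda>n. c (n + m) * t ^ n) sums 0" if "t \<noteq> 0" "norm t < 1" for t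
  proof -
    have "(\<lambda>n. c (n + m) * t ^ (n + m)) sums (0 - (\<Sum>k<m. c k * t ^ k))"
      using c[of t] that by (intro sums_split_initial_segment) simp
    then have "(\<lambda>n. t ^ m * (c (n + m) * t ^ n)) sums (t ^ m * 0)"
      using less by (simp add: power_add mult_ac)
    then show ?thesis
      using that by (subst (asm) sums_mult_iff) auto
  qed
  have "((\<lambda>t::real. 0::real) \<longlongrightarrow> c (0 + m)) (at 0)"
    by (rule powser_limit_0_strong[of 1 "\<lambda>n. c (n + m)"]) (use shifted in auto)
  then show ?case
    by (simp add: tendsto_const_iff)
qed

lemma has_qpowser_unique:
  assumes "has_qpowser f a" "has_qpowser f b"
  shows "a = b"
proof
  fix m
  have "inner (a m - b m) u = 0" for u :: quat
  proof (rule real_powser_eq_0[of "\<lambda>n. inner (a n - b n) u"])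
    fix t :: real
    assume "\<bar>t\<bar> < 1"
    then have "of_real t \<in> ball (0::quat) 1"
      by simp
    then have "(\<lambda>n. of_real t ^ n * a n - of_real t ^ n * b n) sums (f (of_real t) - f (of_real t))"
      using assms unfolding has_qpowser_def by (intro sums_diff) auto
    then have "(\<lambda>n. t ^ n *\<^sub>R (a n - b n)) sums 0"
      by (simp add: scaleR_conv_of_real algebra_simps)
    from bounded_linear.sums[OF bounded_linear_inner_left this, of u]
    show "(\<lambda>n. inner (a n - b n) u * t ^ n) sums 0"
      by (simp add: mult_ac)
  qed
  then show "a m = b m"
    by (metis inner_eq_zero_iff right_minus_eq)
qed

definition qcoeff :: "(quat \<Rightarrow> quat) \<Rightarrow> nat \<Rightarrow> quat"
  where "qcoeff f = (THE a. has_qpowser f a)"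

lemma qcoeff_eq: "has_qpowser f a \<Longrightarrow> qcoeff f = a"
  unfolding qcoeff_def using has_qpowser_unique by blast

definition H2 :: "(quat \<Rightarrow> quat) set"
  where "H2 = {f. \<exists>a. has_qpowser f a \<and> summable (\<lambda>n. (norm (a n))\<^sup>2)}"

definition H2_norm :: "(quat \<Rightarrow> quat) \<Rightarrow> real"
  where "H2_norm f = sqrt (\<Sum>n. (norm (qcoeff f n))\<^sup>2)"

definition star_prod :: "(quat \<Rightarrow> quat) \<Rightarrow> (quat \<Rightarrow> quat) \<Rightarrow> quat \<Rightarrow> quat"  (infixl "\<star>" 70)
  where "(f \<star> g) q = (\<Sum>n. q ^ n * (\<Sum>k\<le>n. qcoeff f k * qcoeff g (n - k)))"

definition qpolys :: "nat \<Rightarrow> (quat \<Rightarrow> quat) set"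
  where "qpolys n = {p. \<exists>a. p = (\<lambda>q. \<Sum>k\<le>n. q ^ k * a k)}"

text \<open>
  The polynomial \<open>p\<close> is the optimal approximant of degree \<open>n\<close> of the \<open>\<star>\<close>-inverse of \<open>f\<close>: it
  minimises the distance of \<open>f \<star> p\<close> to the constant function \<open>1\<close>. For \<open>f \<in> H2\<close> with
  \<open>f 0 \<noteq> 0\<close> there is exactly one such \<open>p\<close>.
\<close>

definition is_optimal_approximant :: "(quat \<Rightarrow> quat) \<Rightarrow> nat \<Rightarrow> (quat \<Rightarrow> quat) \<Rightarrow> bool"
  where "is_optimal_approximant f n p \<longleftrightarrow>
    p \<in> qpolys n \<and>
    (\<forall>r\<in>qpolys n. H2_norm (\<lambda>q. (f \<star> p) q - 1) \<le> H2_norm (\<lambda>q. (f \<star> r) q - 1))"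

end

theory Submission
  imports Defs
begin

text \<open>
  Suppose that the optimal approximant \<open>p\<close> vanishes at \<open>z\<close>. This splits a linear factor off \<open>p\<close>
  on the left, next to \<open>f\<close> in \<open>f \<star> p\<close>, where it is of no use: the Hilbert space is a right one.
  The zero is therefore moved first. The powers of \<open>z\<close> are real combinations of \<open>1\<close> and \<open>z\<close>, and
  so some \<open>w = inverse b * z * b\<close>, which has the norm of \<open>z\<close>, annihilates \<open>p\<close> when the variable
  is written to the right of the coefficients (\<open>left_root_imp_right_root\<close>). Hence
  \<open>p = r \<star> (q - w)\<close> (\<open>right_root_factor\<close>), and \<open>h = f \<star> r\<close> satisfies \<open>f \<star> p = q h - h w\<close>.

  By optimality \<open>f \<star> p - 1\<close> is orthogonal to \<open>f \<star> s\<close> for every polynomial \<open>s\<close> of degree at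
  most \<open>n\<close> (\<open>optimal_approximant_orthogonal\<close>), in particular to \<open>q h\<close>. Since \<open>1\<close> is orthogonal
  to \<open>q h\<close> and multiplication by \<open>q\<close> is an isometry, the squared norm of \<open>h\<close> is the inner product
  of \<open>h w\<close> and \<open>q h\<close>. If \<open>norm w \<le> 1\<close>, the Cauchy--Schwarz inequality must be an equality here,
  which is impossible for \<open>h\<close> and its shift \<open>q h\<close> unless \<open>h = 0\<close> (\<open>shift_inner_eq_imp_zero\<close>). Then
  \<open>f \<star> p = 0\<close>, although \<open>f \<star> p - 1\<close> is orthogonal to \<open>f\<close> times the constant \<open>inverse (f 0)\<close>,
  whose constant term is \<open>1\<close>: a contradiction.

  All of this takes place on coefficient sequences, with the real inner product, which is the real
  part of the quaternionic one.
\<close>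

section \<open>Square summable sequences\<close>

text \<open>Square summability of the norms, that is, membership in \<open>\<ell>\<^sup>2\<close>.\<close>

definition ell2 :: "(nat \<Rightarrow> 'a::real_normed_vector) \<Rightarrow> bool"
  where "ell2 x \<longleftrightarrow> summable (\<lambda>m. (norm (x m))\<^sup>2)"

lemma ell2_add:
  assumes "ell2 x" "ell2 y"
  shows "ell2 (\<lambda>m. x m + y m)"
  unfolding ell2_def
proof (rule summable_comparison_test')
  show "summable (\<lambda>m. 2 * ((norm (x m))\<^sup>2 + (norm (y m))\<^sup>2))"
    using assms unfolding ell2_def by (intro summable_mult summable_add)
  fix m
  have "(norm (x m + y m))\<^sup>2 \<le> (norm (x m) + norm (y m))\<^sup>2"
    by (intro power_mono norm_triangle_ineq norm_ge_zero)
  also have "\<dots> \<le> 2 * ((norm (x m))\<^sup>2 + (norm (y m))\<^sup>2)"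
    using sum_squares_bound[of "norm (x m)" "norm (y m)"] by (simp add: power2_sum)
  finally show "norm ((norm (x m + y m))\<^sup>2) \<le> 2 * ((norm (x m))\<^sup>2 + (norm (y m))\<^sup>2)"
    by simp
qed

lemma ell2_mult_right:
  fixes x :: "nat \<Rightarrow> 'a::real_normed_div_algebra"
  shows "ell2 x \<Longrightarrow> ell2 (\<lambda>m. x m * b)"
  unfolding ell2_def by (simp add: norm_mult power_mult_distrib summable_mult2)

lemma ell2_case_nat: "ell2 x \<Longrightarrow> ell2 (case_nat u x)"
  unfolding ell2_def by (subst summable_Suc_iff[symmetric]) simp

lemma ell2_indicator_0: "ell2 (\<lambda>m. if m = 0 then u else 0)"
  unfolding ell2_def by (rule summable_finite[of "{0}"]) auto

lemma ell2_bounded: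
  assumes "ell2 x"
  obtains M where "\<And>m. norm (x m) \<le> M"
proof -
  have "(\<lambda>m. sqrt ((norm (x m))\<^sup>2)) \<longlonglongrightarrow> sqrt 0"
    using assms unfolding ell2_def by (intro tendsto_real_sqrt summable_LIMSEQ_zero)
  then have "x \<longlonglongrightarrow> 0"
    by (simp add: tendsto_norm_zero_iff)
  then have "Bseq x"
    by (meson convergentI convergent_imp_Bseq)
  then show thesis
    using that unfolding Bseq_def by blast
qed

lemma ell2_summable_inner:
  fixes x y :: "nat \<Rightarrow> 'a::real_inner"
  assumes "ell2 x" "ell2 y"
  shows "summable (\<lambda>m. inner (x m) (y m))"
proof (rule summable_comparison_test')
  show "summable (\<lambda>m. (norm (x m))\<^sup>2 + (norm (y m))\<^sup>2)"
    using assms unfolding ell2_def by (intro summable_add)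
  fix m
  have "\<bar>inner (x m) (y m)\<bar> \<le> norm (x m) * norm (y m)"
    by (rule Cauchy_Schwarz_ineq2)
  moreover have "0 \<le> norm (x m) * norm (y m)"
    by simp
  ultimately show "norm (inner (x m) (y m)) \<le> (norm (x m))\<^sup>2 + (norm (y m))\<^sup>2"
    using sum_squares_bound[of "norm (x m)" "norm (y m)"] by simp
qed

text \<open>First variation: a minimum of the squared norm along a real line is orthogonal to it.\<close>

lemma ell2_minimal_imp_orthogonal:
  fixes x y :: "nat \<Rightarrow> 'a::real_inner"
  assumes x: "ell2 x" and y: "ell2 y"
    and min: "\<And>t::real. (\<Sum>m. (norm (x m))\<^sup>2) \<le> (\<Sum>m. (norm (x m + t *\<^sub>R y m))\<^sup>2)"
  shows "(\<Sum>m. inner (x m) (y m)) = 0"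
proof -
  define I where "I = (\<Sum>m. inner (x m) (y m))"
  define Y where "Y = (\<Sum>m. (norm (y m))\<^sup>2)"
  have Y: "0 \<le> Y"
    using y unfolding Y_def ell2_def by (simp add: suminf_nonneg)
  have quadratic: "0 \<le> 2 * t * I + t\<^sup>2 * Y" for t
  proof -
    have "(\<lambda>m. (norm (x m))\<^sup>2 + 2 * t * inner (x m) (y m) + t\<^sup>2 * (norm (y m))\<^sup>2) sums
        ((\<Sum>m. (norm (x m))\<^sup>2) + 2 * t * I + t\<^sup>2 * Y)"
      using x y ell2_summable_inner[OF x y] unfolding I_def Y_def ell2_def
      by (intro sums_add sums_mult summable_sums)
    moreover have "(norm (x m))\<^sup>2 + 2 * t * inner (x m) (y m) + t\<^sup>2 * (norm (y m))\<^sup>2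
        = (norm (x m + t *\<^sub>R y m))\<^sup>2" for m
      unfolding power2_norm_eq_inner
      by (simp add: inner_add inner_commute[of "y m" "x m"] algebra_simps power2_eq_square[of t])
    ultimately have "(\<Sum>m. (norm (x m + t *\<^sub>R y m))\<^sup>2)
        = (\<Sum>m. (norm (x m))\<^sup>2) + 2 * t * I + t\<^sup>2 * Y"
      by (simp add: sums_iff)
    with min[of t] show ?thesis
      by simp
  qed
  \<comment> \<open>The quadratic is negative near its minimum unless \<open>I = 0\<close>; \<open>Y + 1\<close> avoids division by 0.\<close>
  have "2 * (- I / (Y + 1)) * I + (- I / (Y + 1))\<^sup>2 * Y = - (I\<^sup>2 * (Y + 2) / (Y + 1)\<^sup>2)"
    using Y by (simp add: power2_eq_square divide_simps) (simp add: algebra_simps)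
  with quadratic[of "- I / (Y + 1)"] have "I\<^sup>2 * (Y + 2) / (Y + 1)\<^sup>2 \<le> 0"
    by simp
  then have "I\<^sup>2 \<le> 0"
    using Y by (simp add: divide_le_0_iff mult_le_0_iff)
  then show ?thesis
    by (simp add: I_def)
qed

text \<open>
  The right-hand side of the hypothesis is the inner product of \<open>h w\<close> and the shift of \<open>h\<close>. The
  Cauchy--Schwarz estimate, applied term by term, loses the squared norm of \<open>h 0\<close> and the squares of
  all \<open>norm (h m) - norm (h (Suc m))\<close>. There is nothing to lose, so all these vanish.
\<close>

lemma shift_inner_eq_imp_zero:
  fixes h :: "nat \<Rightarrow> quat"
  assumes h: "ell2 h" and w: "norm w \<le> 1"
    and eq: "(\<Sum>m. (norm (h m))\<^sup>2) = (\<Sum>m. inner (h (Suc m) * w) (h m))"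
  shows "h m = 0"
proof -
  define N where "N = (\<Sum>m. (norm (h m))\<^sup>2)"
  have hs: "summable (\<lambda>m. (norm (h m))\<^sup>2)"
    using h by (simp add: ell2_def)
  then have hs': "summable (\<lambda>m. (norm (h (Suc m)))\<^sup>2)"
    by (subst summable_Suc_iff)
  then have "ell2 (\<lambda>m. h (Suc m))"
    by (simp add: ell2_def)
  then have hi: "summable (\<lambda>m. inner (h (Suc m) * w) (h m))"
    using h by (intro ell2_summable_inner ell2_mult_right)
  have pos: "(norm (h m) - norm (h (Suc m)))\<^sup>2
      \<le> (norm (h m))\<^sup>2 + (norm (h (Suc m)))\<^sup>2 - 2 * inner (h (Suc m) * w) (h m)" for m
  proof -
    have "inner (h (Suc m) * w) (h m) \<le> norm (h (Suc m) * w) * norm (h m)"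
      by (rule norm_cauchy_schwarz)
    also have "\<dots> = norm w * (norm (h (Suc m)) * norm (h m))"
      by (simp add: norm_mult)
    also have "\<dots> \<le> 1 * (norm (h (Suc m)) * norm (h m))"
      using w by (intro mult_right_mono) auto
    finally show ?thesis
      by (simp add: power2_diff mult.commute)
  qed
  have "(\<Sum>m. (norm (h (Suc m)))\<^sup>2) = N - (norm (h 0))\<^sup>2"
    using suminf_split_head[OF hs] by (simp add: N_def)
  then have tot: "(\<lambda>m. (norm (h m))\<^sup>2 + (norm (h (Suc m)))\<^sup>2 - 2 * inner (h (Suc m) * w) (h m))
      sums (N + (N - (norm (h 0))\<^sup>2) - 2 * N)"
    using hs hs' hi eq[symmetric] unfolding N_def
    by (intro sums_add sums_diff sums_mult) (simp_all add: sums_iff)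
  have ge0: "0 \<le> (norm (h m))\<^sup>2 + (norm (h (Suc m)))\<^sup>2 - 2 * inner (h (Suc m) * w) (h m)" for m
    using pos[of m] zero_le_power2 order_trans by blast
  have "0 \<le> - (norm (h 0))\<^sup>2"
    using sums_le[OF _ sums_zero tot] ge0 by simp
  then have h0: "h 0 = 0"
    by simp
  then have "(norm (h m))\<^sup>2 + (norm (h (Suc m)))\<^sup>2 - 2 * inner (h (Suc m) * w) (h m) = 0" for m
    using tot ge0 suminf_eq_zero_iff[OF sums_summable[OF tot]] by (simp add: sums_iff)
  then have "(norm (h m) - norm (h (Suc m)))\<^sup>2 \<le> 0" for m
    using pos[of m] by simp
  then have step: "norm (h (Suc m)) = norm (h m)" for m
    by simp
  have "norm (h m) = 0"
    by (induction m) (simp_all add: h0 step)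
  then show ?thesis
    by simp
qed


section \<open>Convolution of coefficient sequences\<close>

text \<open>
  The coefficients of a \<open>\<star>\<close>-product. The sequence \<open>case_nat 0 a\<close> belongs to \<open>q\<close> times the series
  with coefficients \<open>a\<close>; since \<open>q\<close> is central for \<open>\<star>\<close>, this shift passes through the product.
\<close>

definition conv :: "(nat \<Rightarrow> 'a::semiring_0) \<Rightarrow> (nat \<Rightarrow> 'a) \<Rightarrow> nat \<Rightarrow> 'a"
  where "conv c a m = (\<Sum>k\<le>m. c k * a (m - k))"

lemma conv_0: "conv c a 0 = c 0 * a 0"
  by (simp add: conv_def)

lemma conv_Suc: "conv c a (Suc m) = conv c (\<lambda>k. a (Suc k)) m + c (Suc m) * a 0"
  by (simp add: conv_def Suc_diff_le)

lemma conv_case_nat_0: "conv c (case_nat 0 a) m = (case m of 0 \<Rightarrow> 0 | Suc i \<Rightarrow> conv c a i)"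
  by (cases m) (simp_all add: conv_0 conv_Suc)

lemma conv_diff_mult_right:
  fixes c :: "nat \<Rightarrow> 'a::ring"
  shows "conv c (\<lambda>k. s k - r k * w) m = conv c s m - conv c r m * w"
  by (simp add: conv_def sum_subtractf sum_distrib_right algebra_simps)

lemma conv_add_scaleR:
  fixes c :: "nat \<Rightarrow> 'a::real_algebra"
  shows "conv c (\<lambda>k. a k + t *\<^sub>R s k) m = conv c a m + t *\<^sub>R conv c s m"
  by (simp add: conv_def sum.distrib scaleR_sum_right algebra_simps)

lemma ell2_conv:
  fixes c :: "nat \<Rightarrow> 'a::real_normed_div_algebra"
  assumes c: "ell2 c" and a: "\<And>k. k \<ge> n \<Longrightarrow> a k = 0"
  shows "ell2 (conv c a)"
  using a
proof (induction n arbitrary: a)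
  case 0
  then have "conv c a = (\<lambda>m. 0)"
    by (simp add: conv_def fun_eq_iff)
  then show ?case
    by (simp add: ell2_def)
next
  case (Suc n)
  have "ell2 (case_nat 0 (conv c (\<lambda>k. a (Suc k))))"
    using Suc by (intro ell2_case_nat Suc.IH) auto
  then have "ell2 (\<lambda>m. case_nat 0 (conv c (\<lambda>k. a (Suc k))) m + c m * a 0)"
    using c by (intro ell2_add ell2_mult_right)
  moreover have "conv c a m = case_nat 0 (conv c (\<lambda>k. a (Suc k))) m + c m * a 0" for m
    by (cases m) (simp_all add: conv_0 conv_Suc)
  ultimately show ?case
    by (simp add: ell2_def)
qed


section \<open>Zeros and right linear factors of quaternionic polynomials\<close>

lemma quat_square: "z * z = (2 * qRe z) *\<^sub>R z - (norm z)\<^sup>2 *\<^sub>R 1" for z :: quat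
  unfolding power2_norm_eq_inner
  by (simp add: quat_eq_iff times_quat_def minus_quat_def scaleR_quat_def one_quat_def
      inner_quat_def algebra_simps power2_eq_square)

lemma quat_power_eq_real_combination:
  "\<exists>\<alpha> \<beta>. z ^ k = \<alpha> *\<^sub>R 1 + \<beta> *\<^sub>R z" for z :: quat
proof (induction k)
  case 0
  have "z ^ 0 = 1 *\<^sub>R 1 + 0 *\<^sub>R z"
    by simp
  then show ?case
    by blast
next
  case (Suc k)
  then obtain \<alpha> \<beta> where "z ^ k = \<alpha> *\<^sub>R 1 + \<beta> *\<^sub>R z"
    by blast
  then have "z ^ Suc k = \<alpha> *\<^sub>R z + \<beta> *\<^sub>R (z * z)"
    by (simp add: algebra_simps)
  also have "\<dots> = (- (\<beta> * (norm z)\<^sup>2)) *\<^sub>R 1 + (\<alpha> + \<beta> * (2 * qRe z)) *\<^sub>R z"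
    by (simp add: quat_square algebra_simps)
  finally show ?case
    by blast
qed

text \<open>
  Zeros for evaluation with the variable on the left and on the right of the coefficients correspond
  up to conjugation by a quaternion. If \<open>p z\<close> reduces to \<open>A + z B\<close> by means of
  \<open>quat_power_eq_real_combination\<close>, then conjugating \<open>z\<close> by \<open>B\<close> gives \<open>A + B w = 0\<close>.
\<close>

lemma left_root_imp_right_root:
  fixes z :: quat
  assumes root: "(\<Sum>k\<in>K. z ^ k * a k) = 0"
  obtains w where "norm w = norm z" "(\<Sum>k\<in>K. a k * w ^ k) = 0"
proof -
  obtain \<alpha> \<beta> where pow: "\<And>k. z ^ k = \<alpha> k *\<^sub>R 1 + \<beta> k *\<^sub>R z"
    using quat_power_eq_real_combination[of z] by metis
  define A where "A = (\<Sum>k\<in>K. \<alpha> k *\<^sub>R a k)"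
  define B where "B = (\<Sum>k\<in>K. \<beta> k *\<^sub>R a k)"
  have AB: "A + z * B = 0"
    using root by (simp add: pow A_def B_def sum.distrib sum_distrib_left algebra_simps)
  \<comment> \<open>Any \<open>w\<close> conjugate to \<open>z\<close> obeys the same reduction of powers, with the same real coefficients.\<close>
  have right: "(\<Sum>k\<in>K. a k * w ^ k) = A + B * w"
    if "\<And>k. w ^ k = \<alpha> k *\<^sub>R 1 + \<beta> k *\<^sub>R w" for w
    by (simp add: that A_def B_def sum.distrib sum_distrib_right algebra_simps)
  show thesis
  proof (cases "B = 0")
    case True
    then show thesis
      using that[of z] right[of z] pow AB by simp
  next
    case False
    define w where "w = inverse B * z * B"
    have conj: "w ^ k = inverse B * z ^ k * B" for k
    proof (induction k)
      case (Suc k)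
      have "w ^ Suc k = w * w ^ k"
        by simp
      also have "\<dots> = inverse B * z * (B * inverse B) * z ^ k * B"
        unfolding Suc.IH by (simp only: w_def mult.assoc)
      finally show ?case
        using False by (simp add: mult.assoc)
    qed (use False in simp)
    have "w ^ k = \<alpha> k *\<^sub>R 1 + \<beta> k *\<^sub>R w" for k
      unfolding conj pow using False by (simp add: w_def algebra_simps)
    then have "(\<Sum>k\<in>K. a k * w ^ k) = A + B * w"
      by (rule right)
    also have "B * w = B * inverse B * (z * B)"
      by (simp only: w_def mult.assoc)
    also have "A + \<dots> = 0"
      using AB False by simp
    finally show thesis
      using that[of w] False by (simp add: w_def norm_mult norm_inverse)
  qed
qed

text \<open>The factorization is \<open>p = r \<star> (q - w)\<close>, where \<open>r\<close> has degree less than \<open>n\<close>.\<close>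

lemma right_root_factor:
  fixes a :: "nat \<Rightarrow> 'a::ring_1"
  assumes root: "(\<Sum>k\<le>n. a k * w ^ k) = 0" and a: "\<And>k. k > n \<Longrightarrow> a k = 0"
  obtains r where "\<And>k. k \<ge> n \<Longrightarrow> r k = 0" "\<And>k. a k = case_nat 0 r k - r k * w"
proof
  \<comment> \<open>Horner's scheme\<close>
  define r where "r j = (\<Sum>k\<in>{Suc j..n}. a k * w ^ (k - Suc j))" for j
  show "r k = 0" if "k \<ge> n" for k
    using that by (simp add: r_def)
  have rw: "r j * w = (\<Sum>k\<in>{Suc j..n}. a k * w ^ (k - j))" for j
    unfolding r_def sum_distrib_right
    by (rule sum.cong)
      (auto simp: mult.assoc power_Suc2[symmetric] Suc_diff_Suc simp del: power_Suc)
  show "a k = case_nat 0 r k - r k * w" for k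
  proof (cases k)
    case 0
    have "{..n} = insert 0 {Suc 0..n}"
      by auto
    with root have "a 0 + r 0 * w = 0"
      by (simp add: rw)
    with 0 show ?thesis
      by (simp add: eq_neg_iff_add_eq_0)
  next
    case (Suc j)
    show ?thesis
    proof (cases "k \<le> n")
      case True
      then have "{Suc j..n} = insert k {Suc k..n}"
        using Suc by auto
      then have "r j = a k + r k * w"
        unfolding rw by (simp add: r_def Suc)
      with Suc show ?thesis
        by simp
    qed (use a Suc in \<open>simp add: r_def\<close>)
  qed
qed


section \<open>Optimal approximants in terms of coefficients\<close>

lemma has_qpowser_poly:
  assumes "\<And>k. k > n \<Longrightarrow> a k = 0"
  shows "has_qpowser (\<lambda>q. \<Sum>k\<le>n. q ^ k * a k) a"
  unfolding has_qpowser_def using assms by (intro ballI sums_finite) (simp_all add: not_le)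

lemma ell2_imp_has_qpowser:
  assumes "ell2 x"
  shows "has_qpowser (\<lambda>q. \<Sum>m. q ^ m * x m) x"
  unfolding has_qpowser_def
proof
  fix q :: quat
  assume "q \<in> ball 0 1"
  then have q: "norm q < 1"
    by simp
  obtain M where M: "\<And>m. norm (x m) \<le> M"
    using ell2_bounded[OF assms] by blast
  have "summable (\<lambda>m. q ^ m * x m)"
  proof (rule summable_comparison_test')
    show "summable (\<lambda>m. norm q ^ m * M)"
      using q by (intro summable_mult2 summable_geometric) simp
    show "norm (q ^ m * x m) \<le> norm q ^ m * M" for m
      by (simp add: norm_mult norm_power M mult_left_mono)
  qed
  then show "(\<lambda>m. q ^ m * x m) sums (\<Sum>m. q ^ m * x m)"
    by (rule summable_sums)
qed

text \<open>The error of the candidate with coefficients \<open>a\<close>, as a norm of a coefficient sequence.\<close>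

lemma H2_norm_star_poly_minus_1:
  assumes f: "has_qpowser f c" and c: "ell2 c" and a: "\<And>k. k > n \<Longrightarrow> a k = 0"
  shows "H2_norm (\<lambda>q. (f \<star> (\<lambda>q. \<Sum>k\<le>n. q ^ k * a k)) q - 1)
    = sqrt (\<Sum>m. (norm (conv c a m - (if m = 0 then 1 else 0)))\<^sup>2)"
proof -
  have "ell2 (conv c a)"
    using c a by (intro ell2_conv[where n = "Suc n"]) auto
  then have "has_qpowser (f \<star> (\<lambda>q. \<Sum>k\<le>n. q ^ k * a k)) (conv c a)"
    using ell2_imp_has_qpowser[of "conv c a"] qcoeff_eq[OF f] qcoeff_eq[OF has_qpowser_poly[OF a]]
    by (simp add: has_qpowser_def star_prod_def conv_def)
  moreover have "(\<lambda>m. q ^ m * (if m = 0 then 1 else 0)) sums 1" for q :: quat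
    using sums_finite[of "{0}" "\<lambda>m. q ^ m * (if m = 0 then 1 else 0)"] by simp
  ultimately have "has_qpowser (\<lambda>q. (f \<star> (\<lambda>q. \<Sum>k\<le>n. q ^ k * a k)) q - 1)
      (\<lambda>m. conv c a m - (if m = 0 then 1 else 0))"
    unfolding has_qpowser_def right_diff_distrib by (intro ballI sums_diff) auto
  then show ?thesis
    by (simp add: H2_norm_def qcoeff_eq)
qed

text \<open>
  Only real multiples of \<open>s\<close> are used as variations, so this is orthogonality in the real sense.
\<close>

lemma optimal_approximant_orthogonal:
  assumes f: "has_qpowser f c" and c: "ell2 c"
    and a: "\<And>k. k > n \<Longrightarrow> a k = 0" and s: "\<And>k. k > n \<Longrightarrow> s k = 0"
    and opt: "is_optimal_approximant f n (\<lambda>q. \<Sum>k\<le>n. q ^ k * a k)"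
  shows "(\<Sum>m. inner (conv c a m - (if m = 0 then 1 else 0)) (conv c s m)) = 0"
proof (rule ell2_minimal_imp_orthogonal)
  have conv: "ell2 (conv c a)" "ell2 (conv c s)"
    using c a s by (auto intro!: ell2_conv[where n = "Suc n"])
  show "ell2 (conv c s)"
    by fact
  show "ell2 (\<lambda>m. conv c a m - (if m = 0 then 1 else 0))"
    using ell2_add[OF conv(1) ell2_indicator_0[of "- 1"]]
    by (rule back_subst[of ell2]) (simp add: fun_eq_iff)
  fix t :: real
  define b where "b k = a k + t *\<^sub>R s k" for k
  have b: "b k = 0" if "k > n" for k
    using that a s by (simp add: b_def)
  have "(\<lambda>q. \<Sum>k\<le>n. q ^ k * b k) \<in> qpolys n"
    unfolding qpolys_def by blast
  then have "H2_norm (\<lambda>q. (f \<star> (\<lambda>q. \<Sum>k\<le>n. q ^ k * a k)) q - 1)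
      \<le> H2_norm (\<lambda>q. (f \<star> (\<lambda>q. \<Sum>k\<le>n. q ^ k * b k)) q - 1)"
    using opt unfolding is_optimal_approximant_def by blast
  then have "(\<Sum>m. (norm (conv c a m - (if m = 0 then 1 else 0)))\<^sup>2)
      \<le> (\<Sum>m. (norm (conv c b m - (if m = 0 then 1 else 0)))\<^sup>2)"
    using H2_norm_star_poly_minus_1[OF f c a] H2_norm_star_poly_minus_1[OF f c b] by simp
  moreover have "conv c b m - (if m = 0 then 1 else 0)
      = conv c a m - (if m = 0 then 1 else 0) + t *\<^sub>R conv c s m" for m
    by (simp add: b_def[abs_def] conv_add_scaleR)
  ultimately show "(\<Sum>m. (norm (conv c a m - (if m = 0 then 1 else 0)))\<^sup>2)
      \<le> (\<Sum>m. (norm (conv c a m - (if m = 0 then 1 else 0) + t *\<^sub>R conv c s m))\<^sup>2)"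
    by simp
qed


section \<open>Location of the zeros\<close>

theorem theorem5p1:
  fixes f p :: "quat \<Rightarrow> quat" and n :: nat
  assumes "f \<in> H2"
    and "f 0 \<noteq> 0"
    and "is_optimal_approximant f n p"
  shows "\<forall>z. p z = 0 \<longrightarrow> z \<notin> cball 0 1"
proof (intro allI impI notI)
  fix z
  assume pz: "p z = 0" and z: "z \<in> cball 0 1"
  obtain c where f: "has_qpowser f c" and c: "ell2 c"
    using assms(1) unfolding H2_def ell2_def by blast
  have "(\<lambda>k. 0 ^ k * c k) sums f 0"
    using f unfolding has_qpowser_def by simp
  moreover have "(\<lambda>k. 0 ^ k * c k) sums c 0"
    using sums_finite[of "{0}" "\<lambda>k. 0 ^ k * c k"] by simp
  ultimately have c0: "c 0 \<noteq> 0"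
    using assms(2) sums_unique2 by metis
  obtain a' where a': "p = (\<lambda>q. \<Sum>k\<le>n. q ^ k * a' k)"
    using assms(3) unfolding is_optimal_approximant_def qpolys_def by blast
  define a where "a k = (if k \<le> n then a' k else 0)" for k
  have a: "a k = 0" if "k > n" for k
    using that by (simp add: a_def)
  have p: "p = (\<lambda>q. \<Sum>k\<le>n. q ^ k * a k)"
    by (simp add: a' a_def)
  note orthogonal = optimal_approximant_orthogonal[OF f c a _ assms(3)[unfolded p]]
  obtain w where w: "norm w = norm z" "(\<Sum>k\<le>n. a k * w ^ k) = 0"
    using left_root_imp_right_root pz[unfolded p] by blast
  obtain r where r: "\<And>k. k \<ge> n \<Longrightarrow> r k = 0" and ar: "\<And>k. a k = case_nat 0 r k - r k * w"
    using right_root_factor[OF w(2) a] by blast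
  define h where "h = conv c r"
  have h: "ell2 h"
    unfolding h_def using c r by (rule ell2_conv)
  have fp: "conv c a m = case_nat 0 h m - h m * w" for m
    unfolding ar[abs_def] conv_diff_mult_right conv_case_nat_0 by (simp add: h_def split: nat.split)
  have "h m = 0" for m
  proof (rule shift_inner_eq_imp_zero[OF h])
    show "norm w \<le> 1"
      using w(1) z by simp
    \<comment> \<open>\<open>f \<star> p - 1\<close> is tested against \<open>q h\<close>; the degree allows it because \<open>r\<close> has degree below \<open>n\<close>.\<close>
    define x where "x m = inner (conv c a m - (if m = 0 then 1 else 0))
      (conv c (case_nat 0 r) m)" for m
    have x: "x 0 = 0" "x (Suc m) = (norm (h m))\<^sup>2 - inner (h (Suc m) * w) (h m)" for m
      by (simp_all add: x_def conv_case_nat_0 fp inner_diff_left power2_norm_eq_inner flip: h_def)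
    have hs: "ell2 (\<lambda>m. h (Suc m))"
      using h unfolding ell2_def by (subst summable_Suc_iff)
    have s1: "summable (\<lambda>m. (norm (h m))\<^sup>2)"
      using h by (simp add: ell2_def)
    have s2: "summable (\<lambda>m. inner (h (Suc m) * w) (h m))"
      using hs h by (intro ell2_summable_inner ell2_mult_right)
    have "summable x"
      using summable_diff[OF s1 s2] by (subst summable_Suc_iff[symmetric]) (simp add: x)
    moreover have "(\<Sum>m. x m) = 0"
      unfolding x_def using r by (intro orthogonal) (auto split: nat.split)
    ultimately have "(\<Sum>m. x (Suc m)) = 0"
      using suminf_split_head[of x] x(1) by simp
    then show "(\<Sum>m. (norm (h m))\<^sup>2) = (\<Sum>m. inner (h (Suc m) * w) (h m))"
      using suminf_diff[OF s1 s2] by (simp add: x)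
  qed
  then have fp0: "conv c a m = 0" for m
    by (simp add: fp split: nat.split)
  \<comment> \<open>\<open>f \<star> s\<close> has constant term 1, so that testing \<open>f \<star> p - 1 = - 1\<close> against it gives \<open>- 1\<close>, not 0.\<close>
  define s where "s k = (if k = 0 then inverse (c 0) else 0)" for k :: nat
  have "(\<Sum>m. inner (conv c a m - (if m = 0 then 1 else 0)) (conv c s m)) = 0"
    by (rule orthogonal) (simp_all add: s_def)
  moreover have "(\<Sum>m. inner (conv c a m - (if m = 0 then 1 else 0)) (conv c s m))
      = inner (- 1) (conv c s 0)"
    by (subst suminf_finite[of "{0}"]) (simp_all add: fp0)
  moreover have "conv c s 0 = 1"
    using c0 by (simp add: conv_0 s_def)
  ultimately show False
    by simp
qed

end
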